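(* Let $A$ be a nonempty string over $\{\mathrm{H},\mathrm{T}\}$ starting with $\mathrm{H}$, chosen by Alice, and suppose Bob chooses his string of the same length afterward. Then Bob can force an infinite game if and only if $A$ is not one of $\mathrm{H}$, $\mathrm{HT}$, $\mathrm{HTH}$, $\mathrm{HTHT}$. That is, there exists a string $B\neq A$ of the same length as $A$ for which the No-Flippancy game with Alice's string $A$ and Bob's string $B$ is infinite, if and only if $A\notin\{\mathrm{H},\mathrm{HT},\mathrm{HTH},\mathrm{HTHT}\}$.
   Context: No-Flippancy game: Alice and Bob have distinct strings $A=A_1\cdots A_n$ and $B=B_1\cdots B_n$ of the same length $n$ over the alphabet $\{\mathrm{H},\mathrm{T}\}$. Starting from the empty sequence, the players alternate turns, Alice going first, and on each turn the current player appends one letter to the sequence (the game output) as follows: let $i<n$ be the maximal length of a suffix of the current sequence that coincides with a prefix of the current player's string ($i=0$ is allowed, via the empty suffix); the player appends the letter with index $i+1$ of their own string. The game ends as soon as $A$ or $B$ appears as a block of consecutive letters in the sequence (necessarily as its suffix, no matter who made the last move); the player whose string appears first wins. If neither string ever appears, the game is infinite. *)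

theory Defs
  imports Main "HOL-Library.Sublist"
begin

datatype coin = H | T

text \<open>
  Length of the longest proper prefix of the player's string \<open>P\<close> that is a suffix of the
  current sequence \<open>s\<close>. For \<open>P \<noteq> []\<close> the set is finite and contains \<open>0\<close>, so the maximum is
  a genuine one.
\<close>
definition overlap :: "coin list \<Rightarrow> coin list \<Rightarrow> nat" where
  "overlap P s = Max {i. i < length P \<and> suffix (take i P) s}"

text \<open>
  The list index is 0-based, so this is the letter with 1-based index \<open>overlap P s + 1\<close>.
\<close>
definition next_letter :: "coin list \<Rightarrow> coin list \<Rightarrow> coin" where
  "next_letter P s = P ! overlap P s"

definition game_over :: "coin list \<Rightarrow> coin list \<Rightarrow> coin list \<Rightarrow> bool" where
  "game_over A B s \<longleftrightarrow> sublist A s \<or> sublist B s"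

text \<open>
  The sequence after (at most) \<open>k\<close> turns, Alice with \<open>A\<close> making the turns of even number
  (counted from 0) and Bob with \<open>B\<close> the others; it no longer changes once the game is over.
\<close>
primrec game_output :: "coin list \<Rightarrow> coin list \<Rightarrow> nat \<Rightarrow> coin list" where
  "game_output A B 0 = []"
| "game_output A B (Suc k) =
     (let s = game_output A B k
      in if game_over A B s then s
         else s @ [next_letter (if even k then A else B) s])"

definition infinite_game :: "coin list \<Rightarrow> coin list \<Rightarrow> bool" where
  "infinite_game A B \<longleftrightarrow> (\<forall>k. \<not> game_over A B (game_output A B k))"

end

theory Submission
  imports Defs
begin

text \<open>
  Bob's winning choices are read off the first letters of \<open>A\<close>; each makes the game periodic from
  some turn on:
  against \<open>HH\<dots>\<close> and \<open>HTHH\<dots>\<close> he takes \<open>TT\<dots>T\<close>, and the output is \<open>HTHTHT\<dots>\<close>;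
  against \<open>HTT\<dots>\<close> he takes \<open>HH\<dots>H\<close>, and the output is \<open>HHTHTHT\<dots>\<close>;
  against \<open>HTHT\<dots>\<close> of length at least 5 he takes any \<open>HHTTT\<dots>\<close>, and the output is \<open>HHTTHHTT\<dots>\<close>.
  The four exceptional strings leave only 26 games, which are played out.
\<close>

section \<open>Overlaps with a sequence given by a letter function\<close>

lemma overlap_props:
  assumes "P \<noteq> []"
  shows "overlap P s < length P" "suffix (take (overlap P s) P) s"
    and "\<And>i. i < length P \<Longrightarrow> suffix (take i P) s \<Longrightarrow> i \<le> overlap P s"
proof -
  let ?I = "{i. i < length P \<and> suffix (take i P) s}"
  have fin: "finite ?I" by simp
  have "0 \<in> ?I" using assms by simp
  then have "Max ?I \<in> ?I" using fin by (intro Max_in) auto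
  then show "overlap P s < length P" "suffix (take (overlap P s) P) s"
    by (auto simp: overlap_def)
  show "i \<le> overlap P s" if "i < length P" "suffix (take i P) s" for i
    unfolding overlap_def using that by (intro Max_ge[OF fin]) simp
qed

text \<open>Writing the output as \<open>map f [0..<k]\<close> turns a suffix match into letter
  equations at positions \<open>k - i + t\<close>, which can be settled by arithmetic on
  \<open>f\<close>.\<close>

lemma suffix_take_map_upt_iff:
  assumes "i < length P"
  shows "suffix (take i P) (map f [0..<k]) \<longleftrightarrow> i \<le> k \<and> (\<forall>t<i. P ! t = f (k - i + t))"
proof (cases "i \<le> k")
  case True
  have "suffix (take i P) (map f [0..<k]) \<longleftrightarrow> take i P = drop (k - i) (map f [0..<k])"
  proof
    assume "suffix (take i P) (map f [0..<k])"
    then obtain zs where zs: "map f [0..<k] = zs @ take i P" by (auto simp: suffix_def)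
    have "length zs = k - i"
      using arg_cong[OF zs, of length] assms by (simp add: min_def)
    then show "take i P = drop (k - i) (map f [0..<k])" using zs by simp
  qed (simp add: suffix_drop)
  also have "\<dots> \<longleftrightarrow> (\<forall>t<i. P ! t = f (k - i + t))"
    using assms True by (auto simp: list_eq_iff_nth_eq drop_map)
  finally show ?thesis using True by simp
next
  case False
  then show ?thesis using assms by (auto dest: suffix_length_le)
qed

text \<open>The overlap itself is a maximal match, so it suffices that every maximal match is
  followed by \<open>c\<close> in \<open>P\<close>. Its exact length can thus stay undetermined when
  all candidates carry the same letter.\<close>

lemma next_letter_map_upt:
  assumes "P \<noteq> []"
    and "\<And>i. \<lbrakk>i < length P; i \<le> k; \<forall>t<i. P ! t = f (k - i + t);
          \<And>j. \<lbrakk>j < length P; j \<le> k; \<forall>t<j. P ! t = f (k - j + t)\<rbrakk> \<Longrightarrow> j \<le> i\<rbrakk> \<Longrightarrow> P ! i = c"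
  shows "next_letter P (map f [0..<k]) = c"
  unfolding next_letter_def
  using overlap_props[OF assms(1), where s = "map f [0..<k]"]
  by (intro assms(2)) (auto simp: suffix_take_map_upt_iff)

lemma sublist_map_uptD:
  assumes "sublist P (map f [0..<k])"
  obtains j where "\<And>t. t < length P \<Longrightarrow> P ! t = f (j + t)"
proof -
  obtain xs ys where *: "map f [0..<k] = xs @ P @ ys"
    using assms by (auto simp: sublist_def)
  have "P ! t = f (length xs + t)" if "t < length P" for t
  proof -
    have "length xs + length P \<le> k" using arg_cong[OF *, of length] by simp
    then show ?thesis
      using arg_cong[OF *, of "\<lambda>zs. zs ! (length xs + t)"] that by (simp add: nth_append)
  qed
  then show thesis by (rule that)
qed

text \<open>An occurrence in a prefix of \<open>f\<close> would start at some position
  \<open>j\<close>, which the last two premises exclude. So no prefix ends the game, and by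
  induction the players write exactly \<open>f\<close>.\<close>

lemma infinite_gameI:
  assumes alice: "\<And>k. even k \<Longrightarrow> next_letter A (map f [0..<k]) = f k"
    and bob: "\<And>k. odd k \<Longrightarrow> next_letter B (map f [0..<k]) = f k"
    and A: "\<And>j. \<exists>t<length A. A ! t \<noteq> f (j + t)"
    and B: "\<And>j. \<exists>t<length B. B ! t \<noteq> f (j + t)"
  shows "infinite_game A B"
proof -
  have over: "\<not> game_over A B (map f [0..<k])" for k
    unfolding game_over_def using A B by (metis sublist_map_uptD)
  have "game_output A B k = map f [0..<k]" for k
    by (induction k) (simp_all add: over alice bob Let_def)
  then show ?thesis by (simp add: infinite_game_def over)
qed

section \<open>Infinite games against the non-exceptional strings\<close>

lemma next_letter_replicate: "n > 0 \<Longrightarrow> next_letter (replicate n c) s = c"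
  using overlap_props(1)[of "replicate n c" s] by (simp add: next_letter_def)

text \<open>In an alternating output \<open>HH\<close> never occurs, so Alice has overlap 0 or 1,
  and both continue with \<open>H\<close>.\<close>

lemma infinite_game_HH:
  assumes "A = H # H # X"
  shows "infinite_game A (replicate (length A) T)"
proof (rule infinite_gameI[where f = "\<lambda>k. if even k then H else T"])
  fix k :: nat assume "even k"
  show "next_letter A (map (\<lambda>k. if even k then H else T) [0..<k]) = (if even k then H else T)"
  proof (rule next_letter_map_upt)
    fix i assume *: "\<forall>t<i. A ! t = (if even (k - i + t) then H else T)"
    have "i < 2"
    proof (rule ccontr)
      assume "\<not> i < 2"
      then show False using assms *[rule_format, of 0] *[rule_format, of 1] by (auto split: if_splits)
    qed
    then show "A ! i = (if even k then H else T)" using assms \<open>even k\<close> by (auto simp: less_2_cases_iff)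
  qed (use assms in simp)
next
  fix j :: nat
  show "\<exists>t<length A. A ! t \<noteq> (if even (j + t) then H else T)"
    \<comment> \<open>The witness puts \<open>j + t\<close> at an odd position, where
      \<open>f\<close> is \<open>T\<close> but \<open>A\<close> has \<open>H\<close>.\<close>
    using assms by (intro exI[of _ "if even j then 1 else 0"]) auto
  show "\<exists>t<length (replicate (length A) T). replicate (length A) T ! t \<noteq> (if even (j + t) then H else T)"
    using assms by (intro exI[of _ "if even j then 0 else 1"]) auto
qed (use assms in \<open>simp add: next_letter_replicate del: replicate.simps\<close>)

text \<open>The block \<open>HH\<close> at indices 2 and 3 keeps the overlap below 4, and parity
  leaves only 0 and 2, both followed by \<open>H\<close> in \<open>A\<close>.\<close>

lemma infinite_game_HTHH:
  assumes "A = H # T # H # H # X"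
  shows "infinite_game A (replicate (length A) T)"
proof (rule infinite_gameI[where f = "\<lambda>k. if even k then H else T"])
  fix k :: nat assume "even k"
  show "next_letter A (map (\<lambda>k. if even k then H else T) [0..<k]) = (if even k then H else T)"
  proof (rule next_letter_map_upt)
    fix i assume "i \<le> k" and *: "\<forall>t<i. A ! t = (if even (k - i + t) then H else T)"
    have "i < 4"
    proof (rule ccontr)
      assume "\<not> i < 4"
      then show False using assms *[rule_format, of 2] *[rule_format, of 3] by (auto split: if_splits)
    qed
    \<comment> \<open>A nonempty match starts with \<open>H\<close>, hence at an even position
      \<open>k - i\<close>.\<close>
    moreover have "even i"
      using assms *[rule_format, of 0] \<open>i \<le> k\<close> \<open>even k\<close> by (cases "i = 0") (auto split: if_splits)
    ultimately have "i = 0 \<or> i = 2" by presburger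
    then show "A ! i = (if even k then H else T)" using assms \<open>even k\<close> by auto
  qed (use assms in simp)
next
  fix j :: nat
  show "\<exists>t<length A. A ! t \<noteq> (if even (j + t) then H else T)"
    using assms by (intro exI[of _ "if even j then 3 else 2"]) auto
  show "\<exists>t<length (replicate (length A) T). replicate (length A) T ! t \<noteq> (if even (j + t) then H else T)"
    using assms by (intro exI[of _ "if even j then 0 else 1"]) auto
qed (use assms in \<open>simp add: next_letter_replicate del: replicate.simps\<close>)

text \<open>Alice opens with \<open>H\<close>, the exception at \<open>k = 0\<close>. Afterwards she
  always moves after an \<open>H\<close> of Bob, and since \<open>TT\<close> never occurs her
  overlap is 1 or 2, both followed by \<open>T\<close> in \<open>A\<close>.\<close>

lemma infinite_game_HTT:
  assumes "A = H # T # T # X"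
  shows "infinite_game A (replicate (length A) H)"
proof (rule infinite_gameI[where f = "\<lambda>k. if k = 0 \<or> odd k then H else T"])
  let ?f = "\<lambda>k::nat. if k = 0 \<or> odd k then H else T"
  fix k :: nat assume "even k"
  show "next_letter A (map ?f [0..<k]) = ?f k"
  proof (rule next_letter_map_upt)
    fix i assume "i \<le> k" and *: "\<forall>t<i. A ! t = ?f (k - i + t)"
      and max: "\<And>j. \<lbrakk>j < length A; j \<le> k; \<forall>t<j. A ! t = ?f (k - j + t)\<rbrakk> \<Longrightarrow> j \<le> i"
    show "A ! i = ?f k"
    proof (cases "k = 0")
      case True
      then show ?thesis using assms \<open>i \<le> k\<close> by simp
    next
      case False
      have "i < 3"
      proof (rule ccontr)
        assume "\<not> i < 3"
        then show False using assms *[rule_format, of 1] *[rule_format, of 2] by (auto split: if_splits)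
      qed
      moreover have "1 \<le> i" using max[of 1] assms False \<open>even k\<close> by auto
      ultimately have "i = 1 \<or> i = 2" by auto
      then show ?thesis using assms False \<open>even k\<close> by auto
    qed
  qed (use assms in simp)
next
  fix j :: nat
  show "\<exists>t<length A. A ! t \<noteq> (if j + t = 0 \<or> odd (j + t) then H else T)"
    using assms by (intro exI[of _ "if even j then 1 else 2"]) auto
  show "\<exists>t<length (replicate (length A) H). replicate (length A) H ! t \<noteq> (if j + t = 0 \<or> odd (j + t) then H else T)"
    \<comment> \<open>A positive even position is sought, where \<open>f\<close> is
      \<open>T\<close>; position 0 carries \<open>H\<close>, so \<open>j = 0\<close> takes
      \<open>t = 2\<close>.\<close>
    using assms by (intro exI[of _ "if j = 0 then 2 else if even j then 0 else 1"]) auto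
qed (use assms in \<open>simp add: next_letter_replicate del: replicate.simps\<close>)

text \<open>The output has period \<open>HHTT\<close>, in which neither \<open>HTH\<close> nor
  \<open>TTT\<close> occurs. The fifth letter lets Bob's string contain \<open>TTT\<close>;
  \<open>HHTT\<close> alone would appear and end the game.\<close>

lemma infinite_game_HTHT:
  assumes "A = H # T # H # T # a # X" "B = H # H # T # T # T # Y"
  shows "infinite_game A B"
proof -
  define f where "f k = (if k mod 4 < 2 then H else T)" for k :: nat
  have f_H [simp]: "f k = H \<longleftrightarrow> k mod 4 < 2" "H = f k \<longleftrightarrow> k mod 4 < 2" for k by (auto simp: f_def)
  have f_T [simp]: "f k = T \<longleftrightarrow> \<not> k mod 4 < 2" "T = f k \<longleftrightarrow> \<not> k mod 4 < 2" for k by (auto simp: f_def)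
  have no_HTH: "\<not> (f q = H \<and> f (q + 1) = T \<and> f (q + 2) = H)" for q
    unfolding f_H f_T by presburger
  \<comment> \<open>The offsets 2, 3, 4 are the places of \<open>TTT\<close> in
    \<open>B\<close>.\<close>
  have no_TTT: "\<not> (f (q + 2) = T \<and> f (q + 3) = T \<and> f (q + 4) = T)" for q
    unfolding f_T by presburger
  show ?thesis
  proof (rule infinite_gameI[where f = f])
    show "\<exists>t<length A. A ! t \<noteq> f (j + t)" for j
    proof (rule ccontr)
      assume "\<not> ?thesis"
      then have *: "\<forall>t<length A. A ! t = f (j + t)" by blast
      show False
        using *[rule_format, of 0] *[rule_format, of 1] *[rule_format, of 2] no_HTH[of j] assms(1)
        by simp
    qed
    show "\<exists>t<length B. B ! t \<noteq> f (j + t)" for j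
    proof (rule ccontr)
      assume "\<not> ?thesis"
      then have *: "\<forall>t<length B. B ! t = f (j + t)" by blast
      show False
        using *[rule_format, of 2] *[rule_format, of 3] *[rule_format, of 4] no_TTT[of j] assms(2)
        by simp
    qed
    fix k :: nat
    show "next_letter A (map f [0..<k]) = f k" if "even k"
    proof (rule next_letter_map_upt)
      fix i assume "i \<le> k" and *: "\<forall>t<i. A ! t = f (k - i + t)"
        and max: "\<And>j. \<lbrakk>j < length A; j \<le> k; \<forall>t<j. A ! t = f (k - j + t)\<rbrakk> \<Longrightarrow> j \<le> i"
      obtain q where q: "k = q + i" using \<open>i \<le> k\<close> by (metis le_add_diff_inverse2)
      then have *: "\<forall>t<i. A ! t = f (q + t)" using * by simp
      have "i < 3"
      proof (rule ccontr)
        assume "\<not> i < 3"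
        then show False
          using *[rule_format, of 0] *[rule_format, of 1] *[rule_format, of 2] no_HTH[of q] assms(1)
          by simp
      qed
      then consider "i = 0" | "i = 1" | "i = 2" by linarith
      then show "A ! i = f k"
      proof cases
        case 1
        \<comment> \<open>At \<open>k mod 4 = 2\<close> the preceding letter is \<open>H\<close>, a
          match of length 1 contradicting the maximality of \<open>i = 0\<close>.\<close>
        have "k mod 4 = 0"
        proof (rule ccontr)
          assume "k mod 4 \<noteq> 0"
          then have "k mod 4 = 2" using \<open>even k\<close> by presburger
          then have "\<exists>r. k = Suc r \<and> r mod 4 < 2" by presburger
          then obtain r where "k = Suc r" "r mod 4 < 2" by blast
          then show False using max[of 1] assms(1) 1 by simp
        qed
        then show ?thesis using assms(1) 1 by simp
      next
        case 2
        then have "q mod 4 < 2" using *[rule_format, of 0] assms(1) by simp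
        then have "\<not> k mod 4 < 2" using q 2 \<open>even k\<close> by presburger
        then show ?thesis using assms(1) 2 by simp
      next
        case 3
        then have "q mod 4 < 2" "\<not> (q + 1) mod 4 < 2"
          using *[rule_format, of 0] *[rule_format, of 1] assms(1) by simp_all
        \<comment> \<open>This case is vacuous: ending in \<open>HT\<close> forces
          \<open>q mod 4 = 1\<close>, so \<open>k\<close> would be odd.\<close>
        then have "k mod 4 < 2" using q 3 \<open>even k\<close> by presburger
        then show ?thesis using assms(1) 3 by simp
      qed
    qed (use assms(1) in simp)
    show "next_letter B (map f [0..<k]) = f k" if "odd k"
    proof (rule next_letter_map_upt)
      fix i assume "i \<le> k" and *: "\<forall>t<i. B ! t = f (k - i + t)"
        and max: "\<And>j. \<lbrakk>j < length B; j \<le> k; \<forall>t<j. B ! t = f (k - j + t)\<rbrakk> \<Longrightarrow> j \<le> i"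
      obtain q where q: "k = q + i" using \<open>i \<le> k\<close> by (metis le_add_diff_inverse2)
      then have *: "\<forall>t<i. B ! t = f (q + t)" using * by simp
      have "i < 5"
      proof (rule ccontr)
        assume "\<not> i < 5"
        then show False
          using *[rule_format, of 2] *[rule_format, of 3] *[rule_format, of 4] no_TTT[of q] assms(2)
          by simp
      qed
      show "B ! i = f k"
      \<comment> \<open>At \<open>k mod 4 = 1\<close> the preceding letter is the first
        \<open>H\<close> of a pair, so the overlap is exactly 1. Otherwise the last three letters
        are \<open>HHT\<close>, the overlap is 3 or 4, and \<open>T\<close> follows in
        \<open>B\<close> either way.\<close>
      proof (cases "k mod 4 = 1")
        case True
        then have "\<exists>r. k = Suc r \<and> r mod 4 < 2" by presburger
        then obtain r where r: "k = Suc r" "r mod 4 < 2" by blast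
        then have "i \<ge> 1" using max[of 1] assms(2) by simp
        moreover have "i \<noteq> 2"
        proof
          assume "i = 2"
          then have "q mod 4 < 2" using *[rule_format, of 0] assms(2) by simp
          then show False using True q \<open>i = 2\<close> by presburger
        qed
        moreover have "i \<noteq> 3"
        proof
          assume "i = 3"
          then have "\<not> (q + 2) mod 4 < 2" using *[rule_format, of 2] assms(2) by simp
          then show False using True q \<open>i = 3\<close> by presburger
        qed
        moreover have "i \<noteq> 4"
        proof
          assume "i = 4"
          then have "\<not> (q + 3) mod 4 < 2" using *[rule_format, of 3] assms(2) by simp
          then show False using True q \<open>i = 4\<close> by presburger
        qed
        ultimately have "i = 1" using \<open>i < 5\<close> by linarith
        then show ?thesis using assms(2) True by simp
      next
        case False
        then have k: "k mod 4 = 3" using \<open>odd k\<close> by presburger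
        then have "k \<ge> 3" using mod_less_eq_dividend[of k 4] by simp
        then obtain r where r: "k = r + 3" by (metis le_add_diff_inverse2)
        then have "r mod 4 < 2" "(r + 1) mod 4 < 2" "\<not> (r + 2) mod 4 < 2"
          using k by presburger+
        then have "\<forall>t<3. B ! t = f (k - 3 + t)"
          using r assms(2) by (auto simp: less_Suc_eq numeral_3_eq_3 numeral_2_eq_2)
        then have "i \<ge> 3" using max[of 3] \<open>k \<ge> 3\<close> assms(2) by simp
        then have "i = 3 \<or> i = 4" using \<open>i < 5\<close> by linarith
        then show ?thesis using assms(2) k by auto
      qed
    qed (use assms(2) in simp)
  qed
qed

section \<open>The exceptional strings by evaluation\<close>

text \<open>This makes the maximum executable: the filtered list is increasing, and it contains 0
  because the string is nonempty, so its last entry is the maximum.\<close>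

lemma overlap_code [code]:
  "overlap (p # P) s = last (filter (\<lambda>i. suffix (take i (p # P)) s) [0..<length (p # P)])"
    (is "_ = last ?xs")
proof -
  have "0 \<in> set ?xs" by simp
  then have "?xs \<noteq> []" by (metis empty_iff empty_set)
  have "y \<le> last xs" if "sorted xs" "y \<in> set xs" for xs and y :: nat
    using that by (induction xs) auto
  moreover have "sorted ?xs" by (simp only: sorted_wrt_filter sorted_upt)
  ultimately have "Max (set ?xs) = last ?xs"
    using \<open>?xs \<noteq> []\<close> by (intro Max_eqI last_in_set) (blast | simp only: finite_set)+
  moreover have "set ?xs = {i. i < length (p # P) \<and> suffix (take i (p # P)) s}"
    by (simp only: set_filter set_upt) auto
  ultimately show ?thesis by (simp only: overlap_def)
qed

text \<open>
  Unlike the \<open>let\<close> of the definition of \<^const>\<open>game_output\<close>, a separate constant makes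
  \<open>code_simp\<close> evaluate the current sequence only once per turn.
\<close>
definition turn :: "coin list \<Rightarrow> coin list \<Rightarrow> nat \<Rightarrow> coin list \<Rightarrow> coin list" where
  "turn A B k s = (if game_over A B s then s
     else s @ [next_letter (if even k then A else B) s])"

lemma game_output_code [code]:
  "game_output A B 0 = []"
  "game_output A B (Suc k) = turn A B k (game_output A B k)"
  by (simp_all add: turn_def Let_def)

text \<open>The output is constant once the game is over, so looking after turn 7 also detects
  earlier ends. The disjunct \<open>B = A\<close> lets the check run over all words of a given
  length.\<close>

definition ends_within_7 :: "coin list \<Rightarrow> coin list \<Rightarrow> bool" where
  "ends_within_7 A B \<longleftrightarrow> B = A \<or> game_over A B (game_output A B 7)"

lemma short_games_end:
  "list_all (\<lambda>A. list_all (ends_within_7 A) (List.n_lists (length A) [H, T]))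
     [[H], [H, T], [H, T, H], [H, T, H, T]]"
  by code_simp

theorem lemma2:
  fixes A :: "coin list"
  assumes "A \<noteq> []"
    and "hd A = H"
  shows "(\<exists>B. length B = length A \<and> B \<noteq> A \<and> infinite_game A B) \<longleftrightarrow>
         A \<notin> {[H], [H, T], [H, T, H], [H, T, H, T]}"
proof
  assume "\<exists>B. length B = length A \<and> B \<noteq> A \<and> infinite_game A B"
  then obtain B where B: "length B = length A" "B \<noteq> A" "infinite_game A B" by blast
  \<comment> \<open>This places \<open>B\<close> in the list of all words that the evaluation has
    gone through.\<close>
  have "set B \<subseteq> set [H, T]" using coin.exhaust by auto
  then have "B \<in> set (List.n_lists (length A) [H, T])" using B(1) by (simp add: set_n_lists)
  moreover have "\<not> ends_within_7 A B"
    using B by (simp add: ends_within_7_def infinite_game_def)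
  ultimately show "A \<notin> {[H], [H, T], [H, T, H], [H, T, H, T]}"
    using short_games_end unfolding list_all_iff by auto
next
  assume notin: "A \<notin> {[H], [H, T], [H, T, H], [H, T, H, T]}"
  obtain X where X: "A = H # X" using assms by (cases A) auto
  consider Y where "A = H # H # Y" | Y where "A = H # T # T # Y"
    | Y where "A = H # T # H # H # Y" | a Y where "A = H # T # H # T # a # Y"
  proof -
    have *: "xs = [] \<or> (\<exists>ys. xs = H # ys) \<or> (\<exists>ys. xs = T # ys)" for xs
      by (metis coin.exhaust list.exhaust)
    show thesis
      \<comment> \<open>The letters of \<open>A\<close> are exposed one at a time, with
        \<open>tl [] = []\<close> covering short strings. A string that ends before one of the four
        patterns is reached is an exceptional one.\<close>
      using notin *[of X] *[of "tl X"] *[of "tl (tl X)"] *[of "tl (tl (tl X))"] that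
      unfolding X by auto
  qed
  then show "\<exists>B. length B = length A \<and> B \<noteq> A \<and> infinite_game A B"
  proof cases
    case 1
    show ?thesis by (rule exI[of _ "replicate (length A) T"]) (use 1 infinite_game_HH in auto)
  next
    case 2
    show ?thesis by (rule exI[of _ "replicate (length A) H"]) (use 2 infinite_game_HTT in auto)
  next
    case 3
    show ?thesis by (rule exI[of _ "replicate (length A) T"]) (use 3 infinite_game_HTHH in auto)
  next
    case 4
    show ?thesis
      \<comment> \<open>Keeping the tail \<open>Y\<close> of \<open>A\<close> gives Bob's string the
        right length.\<close>
      by (rule exI[of _ "H # H # T # T # T # Y"]) (use 4 infinite_game_HTHT in auto)
  qed
qed

end
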